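(* For every $n$ there exists a 2-CNF formula $\phi$ in $n$ variables such that the satisfiability polytope of $\phi$ has extension complexity at least $2^{\Omega(\sqrt[4]{n})}$.
   Context: For a CNF formula $\phi$ in variables $x_1,\dots,x_n$, the satisfiability polytope of $\phi$ is the convex hull in $\mathbb{R}^n$ of all 0/1 vectors that are satisfying assignments of $\phi$. A 2-CNF (2-SAT) formula is a conjunction of clauses each a disjunction of at most two literals. The extension complexity $\mathrm{xc}(Q)$ of a polytope $Q$ is the minimum number of facets of a polytope $Q'$ such that $Q$ is a linear image of $Q'$. *)

theory Defs
  imports Complex_Main
begin

text \<open>A point of R^m is represented as a function nat => real that vanishes at
  every index >= m (coordinates are indexed 0..m-1).\<close>

definition pts :: "nat \<Rightarrow> (nat \<Rightarrow> real) set" where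
  "pts m = {x. \<forall>i\<ge>m. x i = 0}"

definition conv_hull :: "(nat \<Rightarrow> real) set \<Rightarrow> (nat \<Rightarrow> real) set" where
  "conv_hull V = {x. \<exists>c. (\<forall>v\<in>V. 0 \<le> c v) \<and> (\<Sum>v\<in>V. c v) = 1 \<and>
                        x = (\<lambda>i. \<Sum>v\<in>V. c v * v i)}"

definition polytope_in :: "nat \<Rightarrow> (nat \<Rightarrow> real) set \<Rightarrow> bool" where
  "polytope_in m P \<longleftrightarrow> (\<exists>V. finite V \<and> V \<subseteq> pts m \<and> P = conv_hull V)"

text \<open>Faces of a polytope P in R^m: intersections of P with the boundary
  hyperplane of a valid inequality a.y <= b (including P itself and the empty face).\<close>
definition face_in :: "nat \<Rightarrow> (nat \<Rightarrow> real) set \<Rightarrow> (nat \<Rightarrow> real) set \<Rightarrow> bool" where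
  "face_in m F P \<longleftrightarrow> (\<exists>(a::nat \<Rightarrow> real) (b::real).
      (\<forall>y\<in>P. (\<Sum>i<m. a i * y i) \<le> b) \<and> F = {y\<in>P. (\<Sum>i<m. a i * y i) = b})"

definition aff_indep :: "(nat \<Rightarrow> real) list \<Rightarrow> bool" where
  "aff_indep ps \<longleftrightarrow> (\<forall>c::nat \<Rightarrow> real.
      (\<Sum>j<length ps. c j) = 0 \<and> (\<forall>i. (\<Sum>j<length ps. c j * (ps ! j) i) = 0)
      \<longrightarrow> (\<forall>j<length ps. c j = 0))"

definition affdim :: "(nat \<Rightarrow> real) set \<Rightarrow> int" where
  "affdim S = (if S = {} then -1 else
     int (GREATEST k. \<exists>ps. length ps = Suc k \<and> set ps \<subseteq> S \<and> aff_indep ps))"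

definition facet_in :: "nat \<Rightarrow> (nat \<Rightarrow> real) set \<Rightarrow> (nat \<Rightarrow> real) set \<Rightarrow> bool" where
  "facet_in m F P \<longleftrightarrow> face_in m F P \<and> F \<noteq> {} \<and> affdim F = affdim P - 1"

definition lin_map :: "nat \<Rightarrow> nat \<Rightarrow> (nat \<Rightarrow> nat \<Rightarrow> real) \<Rightarrow> (nat \<Rightarrow> real) \<Rightarrow> (nat \<Rightarrow> real)" where
  "lin_map n m M y = (\<lambda>i. if i < n then (\<Sum>j<m. M i j * y j) else 0)"

definition xc :: "nat \<Rightarrow> (nat \<Rightarrow> real) set \<Rightarrow> nat" where
  "xc n Q = (LEAST f. \<exists>m Q' M. polytope_in m Q' \<and> lin_map n m M ` Q' = Q \<and>
                               f = card {F. facet_in m F Q'})"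

text \<open>A literal is (variable index, polarity): (i, True) is x_i, (i, False) is not x_i.
  A clause is a list of literals; a CNF is a list of clauses.\<close>
type_synonym literal = "nat \<times> bool"
type_synonym clause = "literal list"
type_synonym cnf = "clause list"

definition is_2cnf :: "nat \<Rightarrow> cnf \<Rightarrow> bool" where
  "is_2cnf n \<phi> \<longleftrightarrow> (\<forall>C\<in>set \<phi>. length C \<le> 2 \<and> (\<forall>(v, _)\<in>set C. v < n))"

definition lit_true :: "(nat \<Rightarrow> real) \<Rightarrow> literal \<Rightarrow> bool" where
  "lit_true x l = (if snd l then x (fst l) = 1 else x (fst l) = 0)"

definition satisfies :: "(nat \<Rightarrow> real) \<Rightarrow> cnf \<Rightarrow> bool" where
  "satisfies x \<phi> \<longleftrightarrow> (\<forall>C\<in>set \<phi>. \<exists>l\<in>set C. lit_true x l)"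

definition bool_pts :: "nat \<Rightarrow> (nat \<Rightarrow> real) set" where
  "bool_pts n = {x\<in>pts n. \<forall>i<n. x i = 0 \<or> x i = 1}"

definition sat_polytope :: "nat \<Rightarrow> cnf \<Rightarrow> (nat \<Rightarrow> real) set" where
  "sat_polytope n \<phi> = conv_hull {x\<in>bool_pts n. satisfies x \<phi>}"

end

theory Submission
  imports Defs "HOL-Library.Function_Algebras"
begin

text \<open>
  The formula has variables \<open>x\<^sub>i\<close> and \<open>u\<^sub>i\<^sub>j\<close> with \<open>i, j < k\<close> and clauses
  \<open>u\<^sub>i\<^sub>j \<longrightarrow> x\<^sub>i\<close> and \<open>u\<^sub>i\<^sub>j \<longrightarrow> \<not> x\<^sub>j\<close>. Then \<open>x\<^sub>i x\<^sub>j \<le> x\<^sub>i - u\<^sub>i\<^sub>j\<close>, so for every set \<open>a\<close> of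
  indices the inequality \<open>2 (\<Sum>i\<in>a. x\<^sub>i) - (\<Sum>i,j\<in>a. x\<^sub>i - u\<^sub>i\<^sub>j) \<le> 1\<close> is valid; at the assignment
  \<open>x = 1\<^sub>b\<close>, \<open>u\<^sub>i\<^sub>j = x\<^sub>i (1 - x\<^sub>j)\<close> its slack is \<open>(1 - |a \<inter> b|)\<^sup>2\<close>. In any extension, a point
  outside a nonempty face is outside some facet containing that face, so the facets yield a
  cover by rectangles of the disjoint pairs \<open>(a, b)\<close> with \<open>a \<noteq> {}\<close>, none of which contains a pair with
  \<open>|a \<inter> b| = 1\<close>. By Kaibel and Weltge such a rectangle contains at most \<open>2\<^sup>k\<close> of the \<open>3\<^sup>k\<close>
  disjoint pairs, so there are at least \<open>(3/2)\<^sup>k - 1\<close> facets, with only \<open>k + k\<^sup>2\<close> variables.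
\<close>

subsection \<open>Affine dimension by homogenization\<close>

definition fscale :: "real \<Rightarrow> (nat \<Rightarrow> real) \<Rightarrow> nat \<Rightarrow> real" where
  "fscale c x = (\<lambda>i. c * x i)"

interpretation fs: vector_space fscale
  by unfold_locales (auto simp: fscale_def fun_eq_iff algebra_simps)

text \<open>Not an interpretation: its rule \<open>a * (b * x) = a * b * x\<close> would make simplification with
  \<open>mult.assoc\<close> loop.\<close>
lemma vector_space_pair_fscale: "vector_space_pair fscale ((*) :: real \<Rightarrow> real \<Rightarrow> real)"
  by unfold_locales (auto simp: algebra_simps)

lemma sum_fun_apply:
  fixes f :: "'a \<Rightarrow> 'b \<Rightarrow> 'c::comm_monoid_add"
  shows "(\<Sum>x\<in>A. f x) i = (\<Sum>x\<in>A. f x i)"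
  by (induction A rule: infinite_finite_induct) auto

text \<open>Points of \<open>pts m\<close> vanish at coordinate \<open>m\<close>, which is therefore
  free for the homogenizing 1; affine independence becomes linear independence.\<close>

definition hom :: "nat \<Rightarrow> (nat \<Rightarrow> real) \<Rightarrow> nat \<Rightarrow> real" where
  "hom m y = y(m := 1)"

lemma inj_on_hom: "inj_on (hom m) (pts m)"
proof (rule inj_onI)
  fix x y assume "x \<in> pts m" "y \<in> pts m" "hom m x = hom m y"
  then have "x i = y i" for i
    by (cases "i = m") (auto simp: hom_def pts_def dest: fun_cong[of _ _ i])
  then show "x = y" by blast
qed

text \<open>Coordinate \<open>m\<close> of the combination is the sum of the coefficients, so a
  single linear relation encodes both conditions in \<open>aff_indep\<close>.\<close>

lemma sum_fscale_hom_eq_0_iff: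
  assumes "\<And>j. j \<in> J \<Longrightarrow> p j \<in> pts m"
  shows "(\<Sum>j\<in>J. fscale (c j) (hom m (p j))) = 0
     \<longleftrightarrow> (\<Sum>j\<in>J. c j) = 0 \<and> (\<forall>i. (\<Sum>j\<in>J. c j * p j i) = 0)" (is "?l = 0 \<longleftrightarrow> ?r")
proof -
  have 1: "?l i = (if i = m then \<Sum>j\<in>J. c j else \<Sum>j\<in>J. c j * p j i)" for i
    by (simp add: sum_fun_apply fscale_def hom_def)
  have 2: "(\<Sum>j\<in>J. c j * p j m) = 0"
    using assms by (intro sum.neutral) (auto simp: pts_def)
  show ?thesis unfolding fun_eq_iff 1 using 2 by auto
qed

lemma aff_indep_imp_independent:
  assumes ps: "set ps \<subseteq> pts m" and aff: "aff_indep ps"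
  shows "fs.independent (hom m ` set ps)" "card (hom m ` set ps) = length ps"
proof -
  have dist: "distinct ps"
  proof (rule ccontr)
    assume "\<not> distinct ps"
    then obtain j k where jk: "j < length ps" "k < length ps" "j \<noteq> k" "ps ! j = ps ! k"
      by (auto simp: distinct_conv_nth)
    \<comment> \<open>A repeated point gives the affine relation with coefficients 1 and -1.\<close>
    define c where "c = (\<lambda>l. (if l = j then 1 else 0) - (if l = k then 1 else 0) :: real)"
    have "(\<Sum>l<length ps. c l) = 0"
      using jk by (simp add: c_def sum_subtractf)
    moreover have "(\<Sum>l<length ps. c l * (ps ! l) i) = 0" for i
    proof -
      have "c l * (ps ! l) i = (if l = j then (ps ! l) i else 0) - (if l = k then (ps ! l) i else 0)" for l
        by (simp add: c_def)
      then show ?thesis using jk by (simp add: sum_subtractf)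
    qed
    ultimately have "c j = 0" using aff jk(1) unfolding aff_indep_def by blast
    then show False using jk by (simp add: c_def)
  qed
  have inj: "inj_on (hom m) (set ps)" using inj_on_hom ps inj_on_subset by blast
  then show "card (hom m ` set ps) = length ps"
    using dist by (simp add: card_image distinct_card)
  have bij: "bij_betw (\<lambda>j. hom m (ps ! j)) {..<length ps} (hom m ` set ps)"
    using bij_betw_trans[OF bij_betw_nth[OF dist refl refl] inj_on_imp_bij_betw[OF inj]]
    by (simp add: o_def)
  show "fs.independent (hom m ` set ps)"
  proof (rule fs.independent_if_scalars_zero)
    fix f x assume "(\<Sum>x\<in>hom m ` set ps. fscale (f x) x) = 0" and x: "x \<in> hom m ` set ps"
    then have "(\<Sum>j<length ps. fscale (f (hom m (ps ! j))) (hom m (ps ! j))) = 0"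
      by (subst sum.reindex_bij_betw[OF bij])
    then have *: "(\<Sum>j<length ps. f (hom m (ps ! j))) = 0 \<and>
       (\<forall>i. (\<Sum>j<length ps. f (hom m (ps ! j)) * (ps ! j) i) = 0)"
      using ps by (subst (asm) sum_fscale_hom_eq_0_iff) auto
    have "f (hom m (ps ! j)) = 0" if "j < length ps" for j
      using aff[unfolded aff_indep_def, rule_format, OF *] that by blast
    then show "f x = 0" using x by (auto simp: in_set_conv_nth)
  qed simp
qed

lemma independent_imp_aff_indep:
  assumes S: "S \<subseteq> pts m" and B: "B \<subseteq> hom m ` S" "finite B" "fs.independent B"
  obtains ps where "length ps = card B" "set ps \<subseteq> S" "aff_indep ps"
proof -
  obtain T where T: "T \<subseteq> S" "B = hom m ` T" using B(1) by (auto simp: subset_image_iff)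
  have inj: "inj_on (hom m) T" using inj_on_hom S T inj_on_subset by blast
  then have "finite T" using B(2) T finite_image_iff by blast
  then obtain ps where ps: "set ps = T" "distinct ps" using finite_distinct_list by blast
  have bij: "bij_betw (\<lambda>j. hom m (ps ! j)) {..<length ps} B"
    using bij_betw_trans[OF bij_betw_nth[OF ps(2) refl refl], of "hom m"] inj_on_imp_bij_betw[OF inj] ps T
    by (simp add: o_def)
  let ?g = "the_inv_into {..<length ps} (\<lambda>j. hom m (ps ! j))"
  have g: "?g (hom m (ps ! j)) = j" if "j < length ps" for j
    using the_inv_into_f_f[OF bij_betw_imp_inj_on[OF bij]] that by simp
  have psm: "ps ! j \<in> pts m" if "j < length ps" for j
    using that ps(1) T(1) S nth_mem by blast
  have "aff_indep ps" unfolding aff_indep_def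
  proof (intro allI impI)
    fix c :: "nat \<Rightarrow> real" and j
    assume "(\<Sum>j<length ps. c j) = 0 \<and> (\<forall>i. (\<Sum>j<length ps. c j * (ps ! j) i) = 0)"
      and j: "j < length ps"
    then have "(\<Sum>j<length ps. fscale (c j) (hom m (ps ! j))) = 0"
      using psm by (subst sum_fscale_hom_eq_0_iff) auto
    then have "(\<Sum>j<length ps. fscale (c (?g (hom m (ps ! j)))) (hom m (ps ! j))) = 0"
      using g by simp
    then have "(\<Sum>b\<in>B. fscale (c (?g b)) b) = 0"
      by (subst (asm) sum.reindex_bij_betw[OF bij])
    then have "c (?g (hom m (ps ! j))) = 0"
      using fs.independentD[OF B(3,2) subset_refl, of "\<lambda>b. c (?g b)"] bij j
      by (auto simp: bij_betw_def)
    then show "c j = 0" using g j by simp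
  qed
  moreover have "length ps = card B" using bij_betw_same_card[OF bij] by simp
  ultimately show thesis using that ps T by blast
qed

abbreviation unit_fun :: "nat \<Rightarrow> nat \<Rightarrow> real" where
  "unit_fun i \<equiv> (\<lambda>j. if j = i then 1 else 0)"

lemma hom_eq_sum_unit:
  assumes "y \<in> pts m"
  shows "hom m y = (\<Sum>i<m. fscale (y i) (unit_fun i)) + unit_fun m"
proof
  fix i
  show "hom m y i = ((\<Sum>i<m. fscale (y i) (unit_fun i)) + unit_fun m) i"
    using assms by (cases "i < m") (auto simp: sum_fun_apply hom_def fscale_def pts_def if_distrib cong: if_cong)
qed

lemma hom_in_span:
  assumes "S \<subseteq> pts m"
  shows "hom m ` S \<subseteq> fs.span (unit_fun ` {..m})"
proof safe
  fix y assume "y \<in> S"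
  then have "y \<in> pts m" using assms by blast
  then show "hom m y \<in> fs.span (unit_fun ` {..m})"
    by (subst hom_eq_sum_unit)
      (auto intro!: fs.span_add fs.span_sum fs.span_scale intro: fs.span_base)
qed

text \<open>The space of all functions is infinite-dimensional, but homogenized points lie in the
  span of \<open>m + 1\<close> unit functions.\<close>

lemma finite_independent_hom:
  assumes "S \<subseteq> pts m" "B \<subseteq> fs.span (hom m ` S)" "fs.independent B"
  shows "finite B"
  using fs.independent_span_bound[of "unit_fun ` {..m}" B] assms
    fs.span_minimal[OF hom_in_span[OF assms(1)]] by auto

text \<open>Trades the \<open>GREATEST\<close> in \<open>affdim\<close> for a linear dimension,
  where bases are at hand. Homogenizing raises the dimension by one, which also matches the value -1
  at the empty set.\<close>

lemma affdim_eq_dim: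
  assumes S: "S \<subseteq> pts m"
  shows "affdim S = int (fs.dim (hom m ` S)) - 1"
proof (cases "S = {}")
  case True
  then show ?thesis using fs.dim_eq_card_independent[OF fs.independent_empty] by (simp add: affdim_def)
next
  case False
  obtain B where B: "B \<subseteq> hom m ` S" "fs.independent B" "hom m ` S \<subseteq> fs.span B"
    "card B = fs.dim (hom m ` S)" using fs.basis_exists by blast
  have fin: "finite B"
    using finite_independent_hom[OF S _ B(2)] B(1) fs.span_superset by blast
  \<comment> \<open>Homogenized points are nonzero at \<open>m\<close>. Nonemptiness keeps the
    natural subtraction \<open>card B - 1\<close> from truncating.\<close>
  have "B \<noteq> {}"
  proof
    assume "B = {}"
    then have "hom m s = 0" if "s \<in> S" for s using B(3) that by auto
    then have "\<exists>s. hom m s = 0" using False by blast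
    then show False by (auto simp: hom_def fun_eq_iff dest: spec[of _ m])
  qed
  then have pos: "card B > 0" using fin by (simp add: card_gt_0_iff)
  have "(GREATEST k. \<exists>ps. length ps = Suc k \<and> set ps \<subseteq> S \<and> aff_indep ps) = card B - 1"
  proof (rule Greatest_equality)
    show "\<exists>ps. length ps = Suc (card B - 1) \<and> set ps \<subseteq> S \<and> aff_indep ps"
      using independent_imp_aff_indep[OF S B(1) fin B(2)] pos by (metis Suc_pred')
  next
    fix k assume "\<exists>ps. length ps = Suc k \<and> set ps \<subseteq> S \<and> aff_indep ps"
    then obtain ps where ps: "length ps = Suc k" "set ps \<subseteq> S" "aff_indep ps" by blast
    have "hom m ` set ps \<subseteq> fs.span B" using ps B by blast
    then have "card (hom m ` set ps) \<le> card B"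
      using fs.independent_span_bound[OF fin] aff_indep_imp_independent[of ps m] ps S by blast
    then show "k \<le> card B - 1"
      using aff_indep_imp_independent(2)[of ps m] ps S by auto
  qed
  then show ?thesis using False pos B(4) by (simp add: affdim_def)
qed

lemma dim_insert_hom:
  assumes S: "S \<subseteq> pts m" and y: "hom m y \<notin> fs.span (hom m ` S)"
  shows "fs.dim (insert (hom m y) (hom m ` S)) = Suc (fs.dim (hom m ` S))"
proof -
  obtain B where B: "B \<subseteq> hom m ` S" "fs.independent B" "hom m ` S \<subseteq> fs.span B"
    "card B = fs.dim (hom m ` S)" using fs.basis_exists by blast
  have fin: "finite B"
    using finite_independent_hom[OF S _ B(2)] B(1) fs.span_superset by blast
  have nB: "hom m y \<notin> fs.span B" using y fs.span_mono[OF B(1)] by blast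
  show ?thesis
  proof (rule fs.dim_unique)
    show "insert (hom m y) B \<subseteq> insert (hom m y) (hom m ` S)" using B by blast
    show "insert (hom m y) (hom m ` S) \<subseteq> fs.span (insert (hom m y) B)"
      using B(3) fs.span_mono[of B "insert (hom m y) B"] fs.span_base by auto
    show "fs.independent (insert (hom m y) B)" using nB B(2) fs.independent_insertI by blast
    show "card (insert (hom m y) B) = Suc (fs.dim (hom m ` S))"
      using nB fs.span_base B(4) fin by (auto simp: card_insert_if)
  qed
qed

text \<open>Extend a basis of the span of \<open>S\<close> by \<open>x\<close> and prescribe values
  there. The value -1 has the sign by which \<open>face_extend\<close> bounds its tilt.\<close>

lemma exists_functional_vanishing:
  assumes "x \<notin> fs.span S"
  obtains g where "Vector_Spaces.linear fscale (*) g" "\<And>s. s \<in> S \<Longrightarrow> g s = (0::real)" "g x = -1"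
proof -
  obtain B where B: "B \<subseteq> S" "fs.independent B" "S \<subseteq> fs.span B" using fs.maximal_independent_subset by blast
  have x: "x \<notin> fs.span B" using assms fs.span_mono[OF B(1)] by blast
  then have "fs.independent (insert x B)" using B(2) fs.independent_insertI by blast
  from vector_space_pair.linear_independent_extend[OF vector_space_pair_fscale this, of "\<lambda>b. if b = x then -1 else 0"]
  obtain g where g: "Vector_Spaces.linear fscale (*) g"
    "\<forall>b\<in>insert x B. g b = (if b = x then -1 else (0::real))"
    by blast
  interpret g: Vector_Spaces.linear fscale "(*)" g by fact
  have 0: "g b = 0" if "b \<in> B" for b using g(2) that x fs.span_base by auto
  have "g s = 0" if "s \<in> fs.span B" for s
    using g.eq_0_on_span[OF _ that] 0 by blast
  moreover have "g x = -1" using g(2) by simp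
  ultimately show thesis using that[OF g(1)] B(3) by blast
qed

subsection \<open>Faces and facets of polytopes\<close>

lemma vertex_in_conv_hull:
  assumes "finite V" "v \<in> V"
  shows "v \<in> conv_hull V"
proof -
  have "v = (\<lambda>i. \<Sum>w\<in>V. (if w = v then 1 else 0) * w i)"
    using assms by (simp add: if_distrib[of "\<lambda>x. x * _"] cong: if_cong)
  then show ?thesis
    using assms by (auto simp: conv_hull_def intro!: exI[of _ "\<lambda>w. if w = v then 1 else 0"])
qed

lemma conv_hull_subset_pts:
  assumes "V \<subseteq> pts m"
  shows "conv_hull V \<subseteq> pts m"
  using assms by (auto simp: conv_hull_def pts_def intro!: sum.neutral)

lemma slack_conv_comb:
  fixes a :: "nat \<Rightarrow> real"
  assumes "(\<Sum>v\<in>V. c v) = 1"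
  shows "b - (\<Sum>i<m. a i * (\<Sum>v\<in>V. c v * v i)) = (\<Sum>v\<in>V. c v * (b - (\<Sum>i<m. a i * v i)))"
proof -
  have "(\<Sum>i<m. a i * (\<Sum>v\<in>V. c v * v i)) = (\<Sum>i<m. \<Sum>v\<in>V. c v * (a i * v i))"
    by (simp add: sum_distrib_left mult_ac)
  also have "\<dots> = (\<Sum>v\<in>V. \<Sum>i<m. c v * (a i * v i))" by (rule sum.swap)
  also have "\<dots> = (\<Sum>v\<in>V. c v * (\<Sum>i<m. a i * v i))" by (simp add: sum_distrib_left)
  finally show ?thesis
    using assms by (simp add: right_diff_distrib sum_subtractf flip: sum_distrib_right)
qed

lemma valid_conv_hull:
  fixes a :: "nat \<Rightarrow> real"
  assumes "\<And>v. v \<in> V \<Longrightarrow> (\<Sum>i<m. a i * v i) \<le> b" and "x \<in> conv_hull V"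
  shows "(\<Sum>i<m. a i * x i) \<le> b"
proof -
  obtain c where c: "\<forall>v\<in>V. 0 \<le> c v" "(\<Sum>v\<in>V. c v) = 1" "x = (\<lambda>i. \<Sum>v\<in>V. c v * v i)"
    using assms(2) unfolding conv_hull_def by blast
  have "0 \<le> (\<Sum>v\<in>V. c v * (b - (\<Sum>i<m. a i * v i)))"
    using assms(1) c(1) by (intro sum_nonneg mult_nonneg_nonneg) auto
  then show ?thesis using slack_conv_comb[OF c(2), of b a m] c(3) by simp
qed

text \<open>A convex combination of nonnegative slacks vanishes only if every point off the face has
  weight 0. Hence a face is determined by the points of \<open>V\<close> it contains.\<close>

lemma face_conv_hull_eq:
  assumes V: "finite V" and F: "face_in m F (conv_hull V)"
  shows "F = {x. \<exists>c. (\<forall>v\<in>V. 0 \<le> c v) \<and> (\<Sum>v\<in>V. c v) = 1 \<and> (\<forall>v\<in>V - F. c v = 0) \<and>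
                   x = (\<lambda>i. \<Sum>v\<in>V. c v * v i)}"
proof -
  obtain a :: "nat \<Rightarrow> real" and b
    where valid: "\<And>y. y \<in> conv_hull V \<Longrightarrow> (\<Sum>i<m. a i * y i) \<le> b"
      and Feq: "F = {y \<in> conv_hull V. (\<Sum>i<m. a i * y i) = b}"
    using F unfolding face_in_def by blast
  define s where "s = (\<lambda>v. b - (\<Sum>i<m. a i * v i))"
  have s: "0 \<le> s v" "s v = 0 \<longleftrightarrow> v \<in> F" if "v \<in> V" for v
    using valid vertex_in_conv_hull[OF V that] Feq by (auto simp: s_def)
  have "(\<lambda>i. \<Sum>v\<in>V. c v * v i) \<in> F \<longleftrightarrow> (\<forall>v\<in>V - F. c v = 0)"
    if c: "\<forall>v\<in>V. 0 \<le> c v" "(\<Sum>v\<in>V. c v) = 1" for c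
  proof -
    have "(\<lambda>i. \<Sum>v\<in>V. c v * v i) \<in> conv_hull V" using c unfolding conv_hull_def by blast
    then have "(\<lambda>i. \<Sum>v\<in>V. c v * v i) \<in> F \<longleftrightarrow> (\<Sum>v\<in>V. c v * s v) = 0"
      using slack_conv_comb[OF c(2), of b a m] by (auto simp: Feq s_def)
    also have "\<dots> \<longleftrightarrow> (\<forall>v\<in>V. c v * s v = 0)"
      using V s c by (intro sum_nonneg_eq_0_iff) auto
    finally show ?thesis using s by auto
  qed
  moreover have "F \<subseteq> conv_hull V" using Feq by blast
  ultimately show ?thesis unfolding conv_hull_def by blast
qed

text \<open>An infinite set has \<open>card\<close> 0, so counting facets bounds nothing until they
  are known to be finitely many.\<close>

lemma finite_faces:
  assumes "polytope_in m P"
  shows "finite {F. face_in m F P}"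
proof -
  obtain V where V: "finite V" "P = conv_hull V" using assms unfolding polytope_in_def by blast
  let ?K = "\<lambda>W. {x. \<exists>c. (\<forall>v\<in>V. 0 \<le> c v) \<and> (\<Sum>v\<in>V. c v) = 1 \<and> (\<forall>v\<in>V - W. c v = 0) \<and>
                   x = (\<lambda>i. \<Sum>v\<in>V. c v * v i)}"
  have "{F. face_in m F P} \<subseteq> ?K ` Pow V"
  proof
    fix F assume "F \<in> {F. face_in m F P}"
    then have "F = ?K F" using face_conv_hull_eq[OF V(1)] V(2) by blast
    also have "\<dots> = ?K (F \<inter> V)" by (simp add: Diff_Int)
    finally show "F \<in> ?K ` Pow V" by blast
  qed
  then show ?thesis using V(1) by (meson finite_Pow_iff finite_imageI finite_subset)
qed

lemma hom_conv_hull_subset_span: "hom m ` conv_hull V \<subseteq> fs.span (hom m ` V)"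
proof safe
  fix x assume "x \<in> conv_hull V"
  then obtain c where c: "(\<Sum>v\<in>V. c v) = 1" "x = (\<lambda>i. \<Sum>v\<in>V. c v * v i)"
    unfolding conv_hull_def by blast
  have "hom m x = (\<Sum>v\<in>V. fscale (c v) (hom m v))"
    using c by (auto simp: fun_eq_iff sum_fun_apply fscale_def hom_def)
  then show "hom m x \<in> fs.span (hom m ` V)"
    by (auto intro!: fs.span_sum fs.span_scale intro: fs.span_base)
qed

lemma linear_functional_hom:
  assumes g: "Vector_Spaces.linear fscale (*) g" and y: "y \<in> pts m"
  shows "g (hom m y) = (\<Sum>i<m. g (unit_fun i) * y i) + g (unit_fun m)"
proof -
  interpret g: Vector_Spaces.linear fscale "(*)" g by fact
  show ?thesis unfolding hom_eq_sum_unit[OF y] g.add g.sum g.scale by (simp add: mult.commute)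
qed

text \<open>The slack of the supporting inequality, homogenized, is a linear functional that is zero
  on \<open>F\<close> and nonzero at \<open>y\<close>.\<close>

lemma hom_notin_span_face:
  assumes P: "P \<subseteq> pts m" and F: "face_in m F P" and y: "y \<in> P" "y \<notin> F"
  shows "hom m y \<notin> fs.span (hom m ` F)"
proof
  assume y_span: "hom m y \<in> fs.span (hom m ` F)"
  obtain a :: "nat \<Rightarrow> real" and b
    where Feq: "F = {y \<in> P. (\<Sum>i<m. a i * y i) = b}"
    using F unfolding face_in_def by blast
  define l where "l = (\<lambda>z. b * z m - (\<Sum>i<m. a i * z i))"
  interpret l: Vector_Spaces.linear fscale "(*)" l
    by unfold_locales (auto simp: l_def fscale_def algebra_simps sum.distrib sum_distrib_left)
  have l: "l (hom m x) = b - (\<Sum>i<m. a i * x i)" for x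
    by (simp add: l_def hom_def)
  have "l z = 0" if "z \<in> hom m ` F" for z
    using that l by (auto simp: Feq)
  then have "l (hom m y) = 0" using l.eq_0_on_span[OF _ y_span] by blast
  then show False using l y Feq by auto
qed

text \<open>Tilting the supporting hyperplane of \<open>F\<close>, keeping \<open>F\<close> and the slack of \<open>y\<close> fixed, until
  it hits another vertex.\<close>
lemma face_extend:
  assumes V: "finite V" "V \<subseteq> pts m" and F: "face_in m F (conv_hull V)"
    and y: "y \<in> conv_hull V" "y \<notin> F"
    and nspan: "\<not> hom m ` V \<subseteq> fs.span (insert (hom m y) (hom m ` F))"
  obtains F' where "face_in m F' (conv_hull V)" "F \<subseteq> F'" "y \<notin> F'" "card (F \<inter> V) < card (F' \<inter> V)"
proof -
  let ?P = "conv_hull V"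
  obtain a :: "nat \<Rightarrow> real" and b
    where valid: "\<And>y. y \<in> ?P \<Longrightarrow> (\<Sum>i<m. a i * y i) \<le> b"
      and Feq: "F = {y \<in> ?P. (\<Sum>i<m. a i * y i) = b}"
    using F unfolding face_in_def by blast
  define s where "s = (\<lambda>v. b - (\<Sum>i<m. a i * v i))"
  obtain w where w: "w \<in> V" "hom m w \<notin> fs.span (insert (hom m y) (hom m ` F))"
    using nspan by blast
  obtain g where g: "Vector_Spaces.linear fscale (*) g"
    "\<And>z. z \<in> insert (hom m y) (hom m ` F) \<Longrightarrow> g z = 0" "g (hom m w) = -1"
    using exists_functional_vanishing[OF w(2)] by metis
  \<comment> \<open>\<open>h\<close> is zero on \<open>F\<close> and at \<open>y\<close> but
    negative at \<open>w\<close>: adding a multiple of it changes no slack on \<open>F\<close> or at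
    \<open>y\<close>.\<close>
  define h where "h = (\<lambda>z. g (hom m z))"
  have P: "?P \<subseteq> pts m" using conv_hull_subset_pts[OF V(2)] .
  have VP: "v \<in> ?P" if "v \<in> V" for v using vertex_in_conv_hull[OF V(1) that] .
  have h_eq: "h z = (\<Sum>i<m. g (unit_fun i) * z i) + g (unit_fun m)" if "z \<in> ?P" for z
    using linear_functional_hom[OF g(1)] P that unfolding h_def by blast
  have hF: "h z = 0" if "z \<in> F" for z using g(2) that by (auto simp: h_def)
  have hy: "h y = 0" using g(2) by (auto simp: h_def)
  have s0: "0 \<le> s z" if "z \<in> ?P" for z using valid[OF that] by (simp add: s_def)
  have sF: "s z = 0 \<longleftrightarrow> z \<in> F" if "z \<in> ?P" for z using that by (auto simp: Feq s_def)
  define N where "N = {v \<in> V. h v < 0}"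
  have N: "finite N" "N \<noteq> {}" using V(1) w g(3) by (auto simp: N_def h_def)
  \<comment> \<open>Ratio test: the largest tilt for which every \<open>s v + t * h v\<close> stays
    nonnegative. The minimizer \<open>u\<close> reaches 0 and so joins the face.\<close>
  define t where "t = Min ((\<lambda>v. s v / - h v) ` N)"
  have "t \<in> (\<lambda>v. s v / - h v) ` N" unfolding t_def using N by (intro Min_in) auto
  then obtain u where u: "u \<in> V" "h u < 0" "t = s u / - h u" by (auto simp: N_def)
  have t_le: "t \<le> s v / - h v" if "v \<in> V" "h v < 0" for v
    unfolding t_def using N that by (intro Min_le) (auto simp: N_def)
  have t0: "0 \<le> t" using u s0[OF VP] by (auto simp: divide_nonneg_neg)
  define a' where "a' = (\<lambda>i. a i - t * g (unit_fun i))"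
  define b' where "b' = b + t * g (unit_fun m)"
  have new: "b' - (\<Sum>i<m. a' i * z i) = s z + t * h z" if "z \<in> ?P" for z
  proof -
    have "(\<Sum>i<m. a' i * z i) = (\<Sum>i<m. a i * z i - t * (g (unit_fun i) * z i))"
      by (rule sum.cong) (auto simp: a'_def algebra_simps)
    also have "\<dots> = (\<Sum>i<m. a i * z i) - t * (\<Sum>i<m. g (unit_fun i) * z i)"
      by (simp only: sum_subtractf sum_distrib_left)
    finally show ?thesis by (simp add: h_eq[OF that] s_def b'_def distrib_left)
  qed
  have "(\<Sum>i<m. a' i * v i) \<le> b'" if v: "v \<in> V" for v
  proof -
    have "0 \<le> s v + t * h v"
    proof (cases "h v < 0")
      case True
      then show ?thesis using t_le[OF v True] by (simp add: field_simps)
    next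
      case False
      then show ?thesis using t0 s0[OF VP[OF v]] by simp
    qed
    then show ?thesis using new[OF VP[OF v]] by simp
  qed
  then have valid': "(\<Sum>i<m. a' i * z i) \<le> b'" if "z \<in> ?P" for z
    using valid_conv_hull that by blast
  define F' where "F' = {z \<in> ?P. (\<Sum>i<m. a' i * z i) = b'}"
  have F': "z \<in> F' \<longleftrightarrow> s z + t * h z = 0" if "z \<in> ?P" for z
    using new[OF that] that by (auto simp: F'_def)
  have "face_in m F' ?P" unfolding face_in_def F'_def using valid' by blast
  moreover have sub: "F \<subseteq> F'"
  proof
    fix z assume z: "z \<in> F"
    then have "z \<in> ?P" using Feq by blast
    then show "z \<in> F'" using F' sF z hF by simp
  qed
  moreover have "y \<notin> F'" using F'[OF y(1)] sF[OF y(1)] y(2) hy by simp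
  moreover have "u \<in> F'" using F'[OF VP[OF u(1)]] u(2,3) by (simp add: field_simps)
  moreover have "u \<notin> F" using hF u(2) by auto
  ultimately have "F \<inter> V \<subset> F' \<inter> V" using u(1) by blast
  then have "card (F \<inter> V) < card (F' \<inter> V)" using V(1) by (intro psubset_card_mono) auto
  then show thesis using that \<open>face_in m F' ?P\<close> sub \<open>y \<notin> F'\<close> by blast
qed

text \<open>Among the faces containing \<open>G\<close> and missing \<open>y\<close>, take one with
  the most points of \<open>V\<close>. If it and \<open>y\<close> did not affinely span
  \<open>P\<close>, \<open>face_extend\<close> would enlarge it; so its dimension is exactly one
  less than that of \<open>P\<close>.\<close>

lemma exists_facet_avoiding:
  assumes P: "polytope_in m P" and G: "face_in m G P" "G \<noteq> {}" and y: "y \<in> P" "y \<notin> G"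
  obtains F where "facet_in m F P" "G \<subseteq> F" "y \<notin> F"
proof -
  obtain V where V: "finite V" "V \<subseteq> pts m" and PV: "P = conv_hull V"
    using P unfolding polytope_in_def by blast
  have Ppts: "P \<subseteq> pts m" using conv_hull_subset_pts[OF V(2)] PV by simp
  let ?Q = "\<lambda>F. face_in m F P \<and> G \<subseteq> F \<and> y \<notin> F"
  have "\<forall>F. ?Q F \<longrightarrow> card (F \<inter> V) < Suc (card V)"
    using card_mono[OF V(1)] by (auto simp: less_Suc_eq_le)
  with G y obtain F where F: "?Q F" and max: "\<And>F'. ?Q F' \<Longrightarrow> card (F' \<inter> V) \<le> card (F \<inter> V)"
    using ex_has_greatest_nat[of ?Q G "\<lambda>F. card (F \<inter> V)" "Suc (card V)"] by blast
  let ?S = "insert (hom m y) (hom m ` F)"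
  have "hom m ` V \<subseteq> fs.span ?S"
  proof (rule ccontr)
    assume nspan: "\<not> ?thesis"
    have "face_in m F (conv_hull V)" "y \<in> conv_hull V" "y \<notin> F" using F y PV by auto
    from face_extend[OF V this nspan]
    obtain F' where "face_in m F' P" "F \<subseteq> F'" "y \<notin> F'" "card (F \<inter> V) < card (F' \<inter> V)"
      unfolding PV by blast
    then show False using max[of F'] F by auto
  qed
  then have "hom m ` P \<subseteq> fs.span ?S"
    using hom_conv_hull_subset_span[of m V] fs.span_minimal[OF _ fs.subspace_span] PV by blast
  moreover have FP: "F \<subseteq> P" using F by (auto simp: face_in_def)
  then have "?S \<subseteq> hom m ` P" using y by blast
  ultimately have "fs.span (hom m ` P) = fs.span ?S"
    by (meson antisym fs.span_minimal fs.span_mono fs.subspace_span)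
  then have "fs.dim (hom m ` P) = fs.dim ?S" by (metis fs.dim_span)
  also have "\<dots> = Suc (fs.dim (hom m ` F))"
    using dim_insert_hom hom_notin_span_face[OF Ppts] F FP Ppts y by (metis order_trans)
  finally have "affdim F = affdim P - 1"
    using affdim_eq_dim[OF Ppts] affdim_eq_dim[of F m] FP Ppts by simp
  then have "facet_in m F P" using F G by (auto simp: facet_in_def)
  then show thesis using that F by blast
qed

subsection \<open>Rectangle covers of the disjoint pairs of sets\<close>

definition disjoint_pairs :: "'a set set \<Rightarrow> 'a set set \<Rightarrow> ('a set \<times> 'a set) set" where
  "disjoint_pairs A B = {(a, b). a \<in> A \<and> b \<in> B \<and> a \<inter> b = {}}"

definition deletion :: "'a \<Rightarrow> 'a set set \<Rightarrow> 'a set set" where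
  "deletion x A = {a. x \<notin> a \<and> a \<in> A}"

definition link :: "'a \<Rightarrow> 'a set set \<Rightarrow> 'a set set" where
  "link x A = {a. x \<notin> a \<and> insert x a \<in> A}"

lemma deletion_link_subset:
  assumes "A \<subseteq> Pow (insert x X)"
  shows "deletion x A \<subseteq> Pow X" "link x A \<subseteq> Pow X"
  using assms by (auto simp: deletion_def link_def)

lemma finite_disjoint_pairs:
  assumes "finite X" "A \<subseteq> Pow X" "B \<subseteq> Pow X"
  shows "finite (disjoint_pairs A B)"
  using assms finite_subset[of "disjoint_pairs A B" "Pow X \<times> Pow X"]
  by (auto simp: disjoint_pairs_def)

text \<open>The element \<open>x\<close> lies in neither set, only in the second or only in the
  first; disjointness excludes both.\<close>

lemma disjoint_pairs_split:
  "disjoint_pairs A B = disjoint_pairs (deletion x A) (deletion x B)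
     \<union> (\<lambda>(a, b). (a, insert x b)) ` disjoint_pairs (deletion x A) (link x B)
     \<union> (\<lambda>(a, b). (insert x a, b)) ` disjoint_pairs (link x A) (deletion x B)"
  (is "_ = ?R")
proof
  show "?R \<subseteq> disjoint_pairs A B" by (auto simp: disjoint_pairs_def deletion_def link_def)
  show "disjoint_pairs A B \<subseteq> ?R"
  proof (rule subrelI)
    fix a b assume "(a, b) \<in> disjoint_pairs A B"
    then have ab: "a \<in> A" "b \<in> B" "a \<inter> b = {}" by (auto simp: disjoint_pairs_def)
    consider "x \<notin> a" "x \<notin> b" | "x \<notin> a" "x \<in> b" | "x \<in> a" "x \<notin> b" using ab by blast
    then show "(a, b) \<in> ?R"
    proof cases
      case 1
      then show ?thesis using ab by (auto simp: disjoint_pairs_def deletion_def)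
    next
      case 2
      then have "(a, b - {x}) \<in> disjoint_pairs (deletion x A) (link x B)"
        using ab by (auto simp: disjoint_pairs_def deletion_def link_def insert_absorb)
      then show ?thesis using 2 by (force simp: insert_absorb)
    next
      case 3
      then have "(a - {x}, b) \<in> disjoint_pairs (link x A) (deletion x B)"
        using ab by (auto simp: disjoint_pairs_def deletion_def link_def insert_absorb)
      then show ?thesis using 3 by (force simp: insert_absorb)
    qed
  qed
qed

lemma card_disjoint_pairs_split:
  assumes X: "finite X" and A: "A \<subseteq> Pow (insert x X)" and B: "B \<subseteq> Pow (insert x X)"
  shows "card (disjoint_pairs A B) = card (disjoint_pairs (deletion x A) (deletion x B))
     + card (disjoint_pairs (deletion x A) (link x B)) + card (disjoint_pairs (link x A) (deletion x B))"
proof -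
  let ?P = "disjoint_pairs (deletion x A) (deletion x B)"
  let ?Q = "disjoint_pairs (deletion x A) (link x B)" and ?r = "\<lambda>(a, b). (a, insert x b)"
  let ?S = "disjoint_pairs (link x A) (deletion x B)" and ?l = "\<lambda>(a, b). (insert x a, b)"
  have fin: "finite ?P" "finite ?Q" "finite ?S"
    using finite_disjoint_pairs[OF X] deletion_link_subset[OF A] deletion_link_subset[OF B] by auto
  have inj: "inj_on ?r ?Q" "inj_on ?l ?S"
    by (auto simp: inj_on_def disjoint_pairs_def deletion_def link_def)
  have "?P \<inter> ?r ` ?Q = {}" by (auto simp: disjoint_pairs_def deletion_def link_def)
  then have "card (?P \<union> ?r ` ?Q) = card ?P + card ?Q"
    using card_Un_disjoint[of ?P "?r ` ?Q"] fin card_image[OF inj(1)] by simp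
  moreover have "(?P \<union> ?r ` ?Q) \<inter> ?l ` ?S = {}"
    by (auto simp: disjoint_pairs_def deletion_def link_def)
  then have "card (?P \<union> ?r ` ?Q \<union> ?l ` ?S) = card (?P \<union> ?r ` ?Q) + card ?S"
    using card_Un_disjoint[of "?P \<union> ?r ` ?Q" "?l ` ?S"] fin card_image[OF inj(2)] by simp
  ultimately show ?thesis using disjoint_pairs_split[of A B x] by metis
qed

text \<open>The induction of Kaibel and Weltge: splitting off \<open>x\<close>, the three families of disjoint pairs
  fit into the two rectangles \<open>deletion x A \<times> (deletion x B \<union> link x B)\<close> and
  \<open>(deletion x A \<union> link x A) \<times> deletion x B\<close>, because \<open>link x A \<times> link x B\<close> contains no
  disjoint pair.\<close>
lemma card_disjoint_pairs_rectangle_le: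
  assumes "finite X" "A \<subseteq> Pow X" "B \<subseteq> Pow X"
    and "\<And>a b. a \<in> A \<Longrightarrow> b \<in> B \<Longrightarrow> card (a \<inter> b) \<noteq> 1"
  shows "card (disjoint_pairs A B) \<le> 2 ^ card X"
  using assms
proof (induction X arbitrary: A B rule: finite_induct)
  case empty
  then have "disjoint_pairs A B \<subseteq> {({}, {})}" by (auto simp: disjoint_pairs_def)
  from card_mono[OF _ this] show ?case by simp
next
  case (insert x X)
  let ?A0 = "deletion x A" and ?A1 = "link x A" and ?B0 = "deletion x B" and ?B1 = "link x B"
  note sub = deletion_link_subset[OF insert.prems(1)] deletion_link_subset[OF insert.prems(2)]
  note finD = finite_disjoint_pairs[OF insert.hyps(1)]
  \<comment> \<open>Here \<open>x\<close> lies in at most one of the two original sets, so removing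
    it leaves the intersection unchanged.\<close>
  have ne: "card (a \<inter> b) \<noteq> 1" if "a \<in> ?A0 \<union> ?A1" "b \<in> ?B0" for a b
    using that insert.prems(3)[of a b] insert.prems(3)[of "insert x a" b]
    by (auto simp: deletion_def link_def)
  have ne': "card (a \<inter> b) \<noteq> 1" if "a \<in> ?A0" "b \<in> ?B0 \<union> ?B1" for a b
    using that insert.prems(3)[of a b] insert.prems(3)[of a "insert x b"]
    by (auto simp: deletion_def link_def)
  have link: "a \<inter> b \<noteq> {}" if "a \<in> ?A1" "b \<in> ?B1" for a b
  proof
    assume "a \<inter> b = {}"
    then have "insert x a \<inter> insert x b = {x}" using that by (auto simp: link_def)
    then have "card (insert x a \<inter> insert x b) = 1" by (metis is_singletonI is_singleton_altdef)
    then show False using insert.prems(3)[of "insert x a" "insert x b"] that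
      by (simp add: link_def)
  qed
  \<comment> \<open>Inclusion-exclusion: the first rectangle holds the union, and the overlap over
    \<open>?B0 \<inter> ?B1\<close> is left for the second rectangle.\<close>
  have "disjoint_pairs ?A0 ?B0 \<union> disjoint_pairs ?A0 ?B1 = disjoint_pairs ?A0 (?B0 \<union> ?B1)"
    "disjoint_pairs ?A0 ?B0 \<inter> disjoint_pairs ?A0 ?B1 = disjoint_pairs ?A0 (?B0 \<inter> ?B1)"
    by (auto simp: disjoint_pairs_def)
  then have "card (disjoint_pairs ?A0 ?B0) + card (disjoint_pairs ?A0 ?B1)
      = card (disjoint_pairs ?A0 (?B0 \<union> ?B1)) + card (disjoint_pairs ?A0 (?B0 \<inter> ?B1))"
    using card_Un_Int[OF finD finD] sub by metis
  \<comment> \<open>The overlap fits beside the third family: a common pair would have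
    \<open>a\<close> in \<open>?A1\<close> and \<open>b\<close> in \<open>?B1\<close>, against
    \<open>link\<close>.\<close>
  moreover have "card (disjoint_pairs ?A0 (?B0 \<inter> ?B1)) + card (disjoint_pairs ?A1 ?B0)
      \<le> card (disjoint_pairs (?A0 \<union> ?A1) ?B0)"
  proof -
    have "disjoint_pairs ?A0 (?B0 \<inter> ?B1) \<inter> disjoint_pairs ?A1 ?B0 = {}"
      using link by (auto simp: disjoint_pairs_def)
    then have "card (disjoint_pairs ?A0 (?B0 \<inter> ?B1)) + card (disjoint_pairs ?A1 ?B0)
       = card (disjoint_pairs ?A0 (?B0 \<inter> ?B1) \<union> disjoint_pairs ?A1 ?B0)"
      using sub by (intro card_Un_disjoint[symmetric] finD) auto
    also have "\<dots> \<le> card (disjoint_pairs (?A0 \<union> ?A1) ?B0)"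
      using sub by (intro card_mono finD) (auto simp: disjoint_pairs_def)
    finally show ?thesis .
  qed
  moreover have "card (disjoint_pairs ?A0 (?B0 \<union> ?B1)) \<le> 2 ^ card X"
    by (rule insert.IH) (use sub in blast, use sub in blast, use ne' in blast)
  moreover have "card (disjoint_pairs (?A0 \<union> ?A1) ?B0) \<le> 2 ^ card X"
    by (rule insert.IH) (use sub in blast, use sub in blast, use ne in blast)
  ultimately have "card (disjoint_pairs A B) \<le> 2 * 2 ^ card X"
    using card_disjoint_pairs_split[OF insert.hyps(1) insert.prems(1,2)] by linarith
  then show ?case using insert.hyps by simp
qed

text \<open>Each element independently lies in the first set, in the second or in neither.\<close>

lemma card_disjoint_pairs_Pow:
  fixes X :: "'a set"
  assumes "finite X"
  shows "card (disjoint_pairs (Pow X) (Pow X)) = 3 ^ card X"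
  using assms
proof (induction X rule: finite_induct)
  case empty
  have "disjoint_pairs (Pow {}) (Pow {}) = {({} :: 'a set, {} :: 'a set)}"
    by (auto simp: disjoint_pairs_def)
  then show ?case by simp
next
  case (insert x X)
  have "deletion x (Pow (insert x X)) = Pow X" "link x (Pow (insert x X)) = Pow X"
    using insert.hyps by (auto simp: deletion_def link_def)
  then show ?case
    using card_disjoint_pairs_split[OF insert.hyps(1) subset_refl subset_refl] insert by simp
qed

text \<open>Pairs with empty first set need not be covered. There are \<open>2 ^ card X\<close> of
  them, as many as one rectangle may hold; hence the \<open>+ 1\<close>.\<close>

lemma rectangle_cover_lower_bound:
  fixes X :: "'a set"
  assumes X: "finite X" and I: "finite I"
    and sub: "\<And>i. i \<in> I \<Longrightarrow> A i \<subseteq> Pow X" "\<And>i. i \<in> I \<Longrightarrow> B i \<subseteq> Pow X"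
    and rect: "\<And>i a b. i \<in> I \<Longrightarrow> a \<in> A i \<Longrightarrow> b \<in> B i \<Longrightarrow> card (a \<inter> b) \<noteq> 1"
    and cover: "\<And>a b. a \<subseteq> X \<Longrightarrow> b \<subseteq> X \<Longrightarrow> a \<noteq> {} \<Longrightarrow> a \<inter> b = {} \<Longrightarrow> \<exists>i\<in>I. a \<in> A i \<and> b \<in> B i"
  shows "3 ^ card X \<le> (card I + 1) * 2 ^ card X"
proof -
  let ?U = "\<Union>i\<in>I. disjoint_pairs (A i) (B i)" and ?E = "{{} :: 'a set} \<times> Pow X"
  have "disjoint_pairs (Pow X) (Pow X) \<subseteq> ?U \<union> ?E"
  proof (rule subrelI)
    fix a b assume "(a, b) \<in> disjoint_pairs (Pow X) (Pow X)"
    then have ab: "a \<subseteq> X" "b \<subseteq> X" "a \<inter> b = {}" by (auto simp: disjoint_pairs_def)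
    show "(a, b) \<in> ?U \<union> ?E"
    proof (cases "a = {}")
      case False
      then show ?thesis using cover[OF ab(1,2) False ab(3)] ab by (auto simp: disjoint_pairs_def)
    qed (use ab in auto)
  qed
  then have "card (disjoint_pairs (Pow X) (Pow X)) \<le> card (?U \<union> ?E)"
    using X I sub finite_disjoint_pairs[OF X] by (intro card_mono) auto
  also have "\<dots> \<le> card ?U + card (?E)" by (rule card_Un_le)
  also have "card ?U \<le> (\<Sum>i\<in>I. card (disjoint_pairs (A i) (B i)))"
    by (rule card_UN_le[OF I])
  also have "\<dots> \<le> (\<Sum>i\<in>I. 2 ^ card X)"
    by (intro sum_mono card_disjoint_pairs_rectangle_le[OF X] sub rect)
  finally show ?thesis
    using card_disjoint_pairs_Pow[OF X] X by (simp add: card_cartesian_product card_Pow)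
qed

subsection \<open>Extension complexity\<close>

text \<open>\<open>Q\<close> is an extension of itself by the identity matrix, so the
  \<open>LEAST\<close> in \<open>xc\<close> ranges over a nonempty set.\<close>

lemma xc_attained:
  assumes "polytope_in n Q"
  obtains m Q' M where "polytope_in m Q'" "lin_map n m M ` Q' = Q" "xc n Q = card {F. facet_in m F Q'}"
proof -
  have "Q \<subseteq> pts n" using assms conv_hull_subset_pts unfolding polytope_in_def by blast
  then have "lin_map n n (\<lambda>i j. if i = j then 1 else 0) x = x" if "x \<in> Q" for x
    using that by (auto simp: lin_map_def pts_def fun_eq_iff if_distrib[of "\<lambda>x. x * _"] cong: if_cong)
  then have "lin_map n n (\<lambda>i j. if i = j then 1 else 0) ` Q = Q" by simp
  with assms have "\<exists>f m Q' M. polytope_in m Q' \<and> lin_map n m M ` Q' = Q \<and> f = card {F. facet_in m F Q'}"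
    by blast
  then show thesis using that LeastI_ex unfolding xc_def by (smt (verit))
qed

text \<open>A facet \<open>F\<close> of an extension \<open>Q'\<close> gives the rectangle of those \<open>(a, b)\<close> for which the face
  of \<open>Q'\<close> induced by the inequality \<open>\<alpha> a\<close> lies in \<open>F\<close> while the chosen preimage of \<open>v b\<close> does
  not; by \<open>exists_facet_avoiding\<close> these rectangles cover all pairs with positive slack.\<close>
lemma xc_lower_bound:
  fixes v :: "'a set \<Rightarrow> nat \<Rightarrow> real" and \<alpha> :: "'a set \<Rightarrow> nat \<Rightarrow> real" and \<beta> :: "'a set \<Rightarrow> real"
  assumes Q: "polytope_in n Q" and X: "finite X"
    and v: "\<And>b. b \<subseteq> X \<Longrightarrow> v b \<in> Q"
    and valid: "\<And>a x. a \<subseteq> X \<Longrightarrow> x \<in> Q \<Longrightarrow> (\<Sum>i<n. \<alpha> a i * x i) \<le> \<beta> a"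
    and tight: "\<And>a b. a \<subseteq> X \<Longrightarrow> b \<subseteq> X \<Longrightarrow> card (a \<inter> b) = 1 \<Longrightarrow> (\<Sum>i<n. \<alpha> a i * v b i) = \<beta> a"
    and slack: "\<And>a b. a \<subseteq> X \<Longrightarrow> b \<subseteq> X \<Longrightarrow> a \<inter> b = {} \<Longrightarrow> (\<Sum>i<n. \<alpha> a i * v b i) \<noteq> \<beta> a"
  shows "3 ^ card X \<le> (xc n Q + 1) * 2 ^ card X"
proof -
  obtain m Q' M where Q': "polytope_in m Q'" "lin_map n m M ` Q' = Q"
    and xc: "xc n Q = card {F. facet_in m F Q'}" using xc_attained[OF Q] .
  have "\<exists>y. y \<in> Q' \<and> lin_map n m M y = v b" if "b \<subseteq> X" for b
    using v[OF that] Q'(2) by (metis imageE)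
  then obtain w where w: "\<And>b. b \<subseteq> X \<Longrightarrow> w b \<in> Q'" "\<And>b. b \<subseteq> X \<Longrightarrow> lin_map n m M (w b) = v b"
    by metis
  \<comment> \<open>Coefficients of the inequality pulled back along \<open>M\<close>; by
    \<open>pull\<close>, its slack at \<open>y\<close> is that of the image of
    \<open>y\<close>.\<close>
  define \<alpha>' where "\<alpha>' = (\<lambda>a j. \<Sum>i<n. \<alpha> a i * M i j)"
  have pull: "(\<Sum>j<m. \<alpha>' a j * y j) = (\<Sum>i<n. \<alpha> a i * lin_map n m M y i)" for a y
  proof -
    have "(\<Sum>j<m. \<alpha>' a j * y j) = (\<Sum>j<m. \<Sum>i<n. \<alpha> a i * M i j * y j)"
      by (simp add: \<alpha>'_def sum_distrib_right)
    also have "\<dots> = (\<Sum>i<n. \<Sum>j<m. \<alpha> a i * M i j * y j)" by (rule sum.swap)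
    finally show ?thesis by (simp add: lin_map_def sum_distrib_left mult.assoc)
  qed
  define G where "G = (\<lambda>a. {y \<in> Q'. (\<Sum>j<m. \<alpha>' a j * y j) = \<beta> a})"
  have wG: "w b \<in> G a \<longleftrightarrow> (\<Sum>i<n. \<alpha> a i * v b i) = \<beta> a" if "b \<subseteq> X" for a b
    using w[OF that] by (simp add: G_def pull)
  have G: "face_in m (G a) Q'" if "a \<subseteq> X" for a
  proof -
    have "(\<Sum>j<m. \<alpha>' a j * y j) \<le> \<beta> a" if "y \<in> Q'" for y
      unfolding pull using valid[OF \<open>a \<subseteq> X\<close>] Q'(2) that by blast
    then show ?thesis unfolding face_in_def G_def by blast
  qed
  let ?A = "\<lambda>F. {a. a \<subseteq> X \<and> G a \<subseteq> F}" and ?B = "\<lambda>F. {b. b \<subseteq> X \<and> w b \<notin> F}"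
  have "finite {F. facet_in m F Q'}"
    using finite_faces[OF Q'(1)] by (rule rev_finite_subset) (auto simp: facet_in_def)
  then show ?thesis unfolding xc
  proof (rule rectangle_cover_lower_bound[OF X, where A = ?A and B = ?B])
    \<comment> \<open>If \<open>card (a \<inter> b) = 1\<close>, tightness puts \<open>w b\<close>
      into \<open>G a\<close>, hence into \<open>F\<close>.\<close>
    fix F a b assume "a \<in> ?A F" "b \<in> ?B F"
    then show "card (a \<inter> b) \<noteq> 1" using tight wG by blast
  next
    fix a b assume ab: "a \<subseteq> X" "b \<subseteq> X" "a \<noteq> {}" "a \<inter> b = {}"
    \<comment> \<open>\<open>exists_facet_avoiding\<close> requires a nonempty face. The singleton
      \<open>{i}\<close> meets \<open>a\<close> in one element, so its preimage lies on
      \<open>G a\<close>; this is where \<open>a \<noteq> {}\<close> enters.\<close>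
    then obtain i where "i \<in> a" by blast
    then have "w {i} \<in> G a" using tight[OF ab(1), of "{i}"] wG[of "{i}"] ab(1) by auto
    then have "G a \<noteq> {}" by blast
    moreover have "w b \<notin> G a" using wG[OF ab(2)] slack[OF ab(1,2,4)] by simp
    ultimately obtain F where "facet_in m F Q'" "G a \<subseteq> F" "w b \<notin> F"
      using exists_facet_avoiding[OF Q'(1) G[OF ab(1)] _ w(1)[OF ab(2)]] by blast
    then show "\<exists>F\<in>{F. facet_in m F Q'}. a \<in> ?A F \<and> b \<in> ?B F" using ab by blast
  qed auto
qed

section \<open>The formula, its vertices and its valid inequalities\<close>

text \<open>The variable \<open>x\<^sub>i\<close> has index \<open>i\<close>, and \<open>u\<^sub>i\<^sub>j\<close> has index \<open>k + i * k + j\<close>.\<close>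
definition difference_formula :: "nat \<Rightarrow> cnf" where
  "difference_formula k = concat (map (\<lambda>i. concat (map (\<lambda>j.
     [[(k + i * k + j, False), (i, True)], [(k + i * k + j, False), (j, False)]]) [0..<k])) [0..<k])"

lemma pair_index_less:
  fixes i j k :: nat
  assumes "i < k" "j < k" shows "i * k + j < k * k"
proof -
  have "i * k + j < (i + 1) * k" using assms by simp
  also have "\<dots> \<le> k * k" using assms by (intro mult_right_mono) auto
  finally show ?thesis .
qed

lemma is_2cnf_difference_formula:
  assumes "k + k * k \<le> n"
  shows "is_2cnf n (difference_formula k)"
proof -
  have "k + i * k + j < n" if "i < k" "j < k" for i j
    using pair_index_less[OF that] assms by linarith
  then show ?thesis using assms by (auto simp: is_2cnf_def difference_formula_def)
qed

lemma satisfies_difference_formula_iff: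
  "satisfies x (difference_formula k) \<longleftrightarrow>
     (\<forall>i<k. \<forall>j<k. (x (k + i * k + j) = 0 \<or> x i = 1) \<and> (x (k + i * k + j) = 0 \<or> x j = 0))"
  unfolding satisfies_def difference_formula_def by (fastforce simp: lit_true_def)

text \<open>\<open>div\<close> and \<open>mod\<close> decode the index \<open>p - k\<close> into the
  pair \<open>(i, j)\<close>. Coordinates from \<open>k + k * k\<close> on are 0, so the point lies
  in \<open>pts n\<close> for every larger \<open>n\<close>.\<close>

definition difference_vec :: "nat \<Rightarrow> nat set \<Rightarrow> nat \<Rightarrow> real" where
  "difference_vec k b p = (if p < k then of_bool (p \<in> b)
     else of_bool (p < k + k * k \<and> (p - k) div k \<in> b \<and> (p - k) mod k \<notin> b))"

lemma difference_vec_pair: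
  assumes "i < k" "j < k"
  shows "difference_vec k b (k + i * k + j) = of_bool (i \<in> b \<and> j \<notin> b)"
  using assms pair_index_less[OF assms] by (simp add: difference_vec_def add.assoc)

lemma difference_vec_sat:
  assumes "k + k * k \<le> n"
  shows "difference_vec k b \<in> {x \<in> bool_pts n. satisfies x (difference_formula k)}"
proof -
  have "difference_vec k b \<in> bool_pts n"
    using assms by (auto simp: bool_pts_def pts_def difference_vec_def)
  moreover have "satisfies (difference_vec k b) (difference_formula k)"
    unfolding satisfies_difference_formula_iff
    using difference_vec_pair by (auto simp: difference_vec_def)
  ultimately show ?thesis by blast
qed

text \<open>Coefficients of \<open>2 (\<Sum>i\<in>a. x\<^sub>i) - (\<Sum>i,j\<in>a. x\<^sub>i - u\<^sub>i\<^sub>j)\<close>.\<close>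
definition square_coeff :: "nat \<Rightarrow> nat set \<Rightarrow> nat \<Rightarrow> real" where
  "square_coeff k a p = (2 - real (card a)) * (\<Sum>i\<in>a. of_bool (p = i))
     + (\<Sum>i\<in>a. \<Sum>j\<in>a. of_bool (p = k + i * k + j))"

lemma sum_square_coeff:
  fixes x :: "nat \<Rightarrow> real"
  assumes n: "k + k * k \<le> n" and a: "a \<subseteq> {..<k}"
  shows "(\<Sum>p<n. square_coeff k a p * x p)
       = (2 - real (card a)) * (\<Sum>i\<in>a. x i) + (\<Sum>i\<in>a. \<Sum>j\<in>a. x (k + i * k + j))"
proof -
  have delta: "(\<Sum>p<n. of_bool (p = q) * x p) = x q" if "q < n" for q
    using that by (simp add: of_bool_def if_distrib[of "\<lambda>x. x * _"] cong: if_cong)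
  have 1: "(\<Sum>p<n. (\<Sum>i\<in>a. of_bool (p = i)) * x p) = (\<Sum>i\<in>a. x i)"
  proof -
    have "(\<Sum>p<n. (\<Sum>i\<in>a. of_bool (p = i)) * x p) = (\<Sum>i\<in>a. \<Sum>p<n. of_bool (p = i) * x p)"
      unfolding sum_distrib_right by (rule sum.swap)
    also have "\<dots> = (\<Sum>i\<in>a. x i)" using n a by (intro sum.cong delta) auto
    finally show ?thesis .
  qed
  have 2: "(\<Sum>p<n. (\<Sum>i\<in>a. \<Sum>j\<in>a. of_bool (p = k + i * k + j)) * x p)
     = (\<Sum>i\<in>a. \<Sum>j\<in>a. x (k + i * k + j))"
  proof -
    have "(\<Sum>p<n. (\<Sum>i\<in>a. \<Sum>j\<in>a. of_bool (p = k + i * k + j)) * x p)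
       = (\<Sum>i\<in>a. \<Sum>p<n. \<Sum>j\<in>a. of_bool (p = k + i * k + j) * x p)"
      unfolding sum_distrib_right by (rule sum.swap)
    also have "\<dots> = (\<Sum>i\<in>a. \<Sum>j\<in>a. \<Sum>p<n. of_bool (p = k + i * k + j) * x p)"
      by (intro sum.cong refl sum.swap)
    also have "\<dots> = (\<Sum>i\<in>a. \<Sum>j\<in>a. x (k + i * k + j))"
    proof (intro sum.cong refl delta)
      fix i j assume "i \<in> a" "j \<in> a"
      then have "i < k" "j < k" using a by auto
      then show "k + i * k + j < n" using pair_index_less[of i k j] n by linarith
    qed
    finally show ?thesis .
  qed
  have "(\<Sum>p<n. square_coeff k a p * x p) = (\<Sum>p<n. (2 - real (card a)) * ((\<Sum>i\<in>a. of_bool (p = i)) * x p)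
      + (\<Sum>i\<in>a. \<Sum>j\<in>a. of_bool (p = k + i * k + j)) * x p)"
    by (simp add: square_coeff_def distrib_right mult.assoc)
  also have "\<dots> = (2 - real (card a)) * (\<Sum>p<n. (\<Sum>i\<in>a. of_bool (p = i)) * x p)
      + (\<Sum>p<n. (\<Sum>i\<in>a. \<Sum>j\<in>a. of_bool (p = k + i * k + j)) * x p)"
    by (simp only: sum.distrib sum_distrib_left)
  finally show ?thesis unfolding 1 2 .
qed

text \<open>With \<open>s\<close> the sum of \<open>x\<close> over \<open>a\<close>, the double sum
  factors as \<open>s * (card a - s)\<close>; the coefficient \<open>2 - card a\<close> cancels its
  term \<open>card a * s\<close>.\<close>

lemma sum_pair_differences:
  fixes x :: "'a \<Rightarrow> real"
  shows "(2 - real (card a)) * (\<Sum>i\<in>a. x i) + (\<Sum>i\<in>a. \<Sum>j\<in>a. x i * (1 - x j))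
       = 2 * (\<Sum>i\<in>a. x i) - (\<Sum>i\<in>a. x i)\<^sup>2"
proof -
  have "(\<Sum>i\<in>a. \<Sum>j\<in>a. x i * (1 - x j)) = (\<Sum>i\<in>a. x i) * (\<Sum>j\<in>a. 1 - x j)"
    by (rule sum_product[symmetric])
  moreover have "(\<Sum>j\<in>a. 1 - x j) = real (card a) - (\<Sum>j\<in>a. x j)"
    by (simp add: sum_subtractf)
  ultimately show ?thesis by (simp only: power2_eq_square) (simp add: algebra_simps)
qed

text \<open>With \<open>t = card (a \<inter> b)\<close> the value is \<open>1 - (1 - t)^2\<close>,
  which is 1 for \<open>t = 1\<close> and 0 for \<open>t = 0\<close>: the tightness and slack that
  \<open>xc_lower_bound\<close> asks for.\<close>

lemma square_coeff_difference_vec: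
  assumes n: "k + k * k \<le> n" and a: "a \<subseteq> {..<k}"
  shows "(\<Sum>p<n. square_coeff k a p * difference_vec k b p)
       = 2 * card (a \<inter> b) - (real (card (a \<inter> b)))\<^sup>2"
proof -
  have fin: "finite a" using a finite_subset by blast
  have "(\<Sum>i\<in>a. difference_vec k b i) = (\<Sum>i\<in>a. of_bool (i \<in> b))"
    using a by (intro sum.cong) (auto simp: difference_vec_def)
  moreover have "(\<Sum>i\<in>a. \<Sum>j\<in>a. difference_vec k b (k + i * k + j))
     = (\<Sum>i\<in>a. \<Sum>j\<in>a. of_bool (i \<in> b) * (1 - of_bool (j \<in> b)))"
    using a by (intro sum.cong refl) (auto simp: difference_vec_pair subset_iff)
  moreover have "(\<Sum>i\<in>a. of_bool (i \<in> b)) = real (card (a \<inter> b))"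
    using fin by (simp add: of_bool_def sum.If_cases Int_def)
  ultimately show ?thesis
    using sum_pair_differences[of a "\<lambda>i. of_bool (i \<in> b)"] sum_square_coeff[OF n a] by simp
qed

text \<open>At 0/1 points the clauses bound each \<open>u\<close> variable by
  \<open>x i * (1 - x j)\<close>. The left side is then at most
  \<open>2 * s - s^2 = 1 - (s - 1)^2\<close>, with \<open>s\<close> the sum of \<open>x\<close> over
  \<open>a\<close>.\<close>

lemma square_coeff_valid:
  assumes n: "k + k * k \<le> n" and a: "a \<subseteq> {..<k}"
    and x: "x \<in> {x \<in> bool_pts n. satisfies x (difference_formula k)}"
  shows "(\<Sum>p<n. square_coeff k a p * x p) \<le> 1"
proof -
  have "x (k + i * k + j) \<le> x i * (1 - x j)" if "i \<in> a" "j \<in> a" for i j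
  proof -
    have ij: "i < k" "j < k" using a that by auto
    then have "k + i * k + j < n" "i < n" "j < n" using pair_index_less[OF ij] n by auto
    then have "x (k + i * k + j) \<in> {0, 1}" "x i \<in> {0, 1}" "x j \<in> {0, 1}"
      using x by (auto simp: bool_pts_def)
    moreover have "x (k + i * k + j) = 0 \<or> x i = 1" "x (k + i * k + j) = 0 \<or> x j = 0"
      using x ij by (auto simp: satisfies_difference_formula_iff)
    ultimately show ?thesis by auto
  qed
  then have "(\<Sum>i\<in>a. \<Sum>j\<in>a. x (k + i * k + j)) \<le> (\<Sum>i\<in>a. \<Sum>j\<in>a. x i * (1 - x j))"
    by (intro sum_mono)
  then have "(\<Sum>p<n. square_coeff k a p * x p) \<le> 2 * (\<Sum>i\<in>a. x i) - (\<Sum>i\<in>a. x i)\<^sup>2"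
    using sum_square_coeff[OF n a, of x] sum_pair_differences[of a x] by linarith
  also have "\<dots> \<le> 1"
    using zero_le_power2[of "(\<Sum>i\<in>a. x i) - 1"] by (simp add: power2_diff)
  finally show ?thesis .
qed

lemma finite_bool_pts: "finite (bool_pts n)"
proof -
  have "bool_pts n \<subseteq> (\<lambda>S i. of_bool (i \<in> S)) ` Pow {..<n}"
  proof
    fix x assume x: "x \<in> bool_pts n"
    have "x i = of_bool (i \<in> {i. i < n \<and> x i = 1})" for i
      using x by (cases "i < n") (auto simp: bool_pts_def pts_def)
    then have "x = (\<lambda>i. of_bool (i \<in> {i. i < n \<and> x i = 1}))" by blast
    then show "x \<in> (\<lambda>S i. of_bool (i \<in> S)) ` Pow {..<n}" by blast
  qed
  then show ?thesis by (rule finite_subset) simp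
qed

lemma polytope_sat_polytope: "polytope_in n (sat_polytope n \<phi>)"
proof -
  have "finite {x \<in> bool_pts n. satisfies x \<phi>}" using finite_bool_pts by simp
  moreover have "{x \<in> bool_pts n. satisfies x \<phi>} \<subseteq> pts n" by (auto simp: bool_pts_def)
  ultimately show ?thesis unfolding polytope_in_def sat_polytope_def by blast
qed

lemma xc_difference_formula:
  assumes n: "k + k * k \<le> n"
  shows "3 ^ k \<le> (xc n (sat_polytope n (difference_formula k)) + 1) * 2 ^ k"
proof -
  let ?V = "{x \<in> bool_pts n. satisfies x (difference_formula k)}"
  have V: "finite ?V" using finite_bool_pts by simp
  have "3 ^ card {..<k} \<le> (xc n (sat_polytope n (difference_formula k)) + 1) * 2 ^ card {..<k}"
  proof (rule xc_lower_bound[OF polytope_sat_polytope, where v = "difference_vec k" and \<alpha> = "square_coeff k" and \<beta> = "\<lambda>_. 1"])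
    fix b :: "nat set"
    show "difference_vec k b \<in> sat_polytope n (difference_formula k)"
      unfolding sat_polytope_def using vertex_in_conv_hull[OF V difference_vec_sat[OF n]] .
  next
    fix a x assume "a \<subseteq> {..<k}" "x \<in> sat_polytope n (difference_formula k)"
    then show "(\<Sum>i<n. square_coeff k a i * x i) \<le> 1"
      unfolding sat_polytope_def using valid_conv_hull square_coeff_valid[OF n] by blast
  qed (auto simp: square_coeff_difference_vec[OF n])
  then show ?thesis by simp
qed

section \<open>Numerical estimates and the asymptotic bound\<close>

text \<open>The exponent \<open>k + 1\<close> absorbs the rounding of the fourth root down to
  \<open>k\<close>, and the summand 1 absorbs the \<open>+ 1\<close> of the cover bound. The
  inequality fails at \<open>k = 3\<close>.\<close>

lemma three_halves_power_ge:
  assumes "k \<ge> 4"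
  shows "(5/4) ^ (k + 1) + 1 \<le> (3/2 :: real) ^ k"
  using assms
proof (induction k rule: dec_induct)
  case (step k)
  have "(5/4) ^ (Suc k + 1) + 1 \<le> 5/4 * ((5/4) ^ (k + 1) + 1 :: real)" by simp
  also have "\<dots> \<le> 5/4 * (3/2) ^ k" using step.IH by (intro mult_left_mono) auto
  also have "\<dots> \<le> (3/2) ^ Suc k" by simp
  finally show ?case .
qed (simp add: eval_nat_numeral)

text \<open>The threshold is \<open>256 = 4 ^ 4\<close>, which makes \<open>k \<ge> 4\<close> as
  \<open>three_halves_power_ge\<close> requires.\<close>

lemma two_powr_root_le:
  assumes n: "n \<ge> 256" and k: "k = nat \<lfloor>root 4 (real n)\<rfloor>"
  shows "k + k * k \<le> n" "2 powr (1/4 * root 4 (real n)) \<le> (3/2) ^ k - 1"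
proof -
  let ?r = "root 4 (real n)"
  have "root 4 256 \<le> ?r" using n by (intro real_root_le_mono) auto
  moreover have "root 4 (256 :: real) = 4" by (rule real_root_pos_unique) auto
  ultimately have r: "4 \<le> ?r" by simp
  then have k_r: "real k \<le> ?r" "?r < real k + 1" "4 \<le> k" unfolding k by linarith+
  have "real k ^ 4 \<le> ?r ^ 4" using k_r by (intro power_mono) auto
  then have k4: "k ^ 4 \<le> n" by (simp flip: of_nat_power)
  have "k + k * k \<le> 2 * (k * k)" by simp
  also have "\<dots> \<le> (k * k) * (k * k)" using k_r(3) mult_mono[of 4 k 4 k] by (intro mult_right_mono) auto
  also have "\<dots> = k ^ 4" by (simp add: power4_eq_xxxx)
  finally show "k + k * k \<le> n" using k4 by linarith
  have "2 powr (1/4 * ?r) \<le> 2 powr (1/4 * real (k + 1))" using k_r by (intro powr_mono) auto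
  also have "\<dots> = (2 powr (1/4)) ^ (k + 1)" by (subst powr_realpow[symmetric]) (simp_all only: powr_powr, simp_all)
  \<comment> \<open>The constant 5/4 lies above the fourth root of 2, since
    \<open>(5/4) ^ 4 = 625/256\<close>.\<close>
  also have "\<dots> \<le> (5/4) ^ (k + 1)"
  proof (intro power_mono)
    have "(2 powr (1/4 :: real)) ^ 4 = 2"
      by (subst powr_realpow[symmetric]) (simp_all only: powr_powr, simp_all)
    then have "(2 powr (1/4 :: real)) ^ 4 \<le> (5/4) ^ 4" by (simp add: eval_nat_numeral)
    then show "2 powr (1/4 :: real) \<le> 5/4" by (subst (asm) power_mono_iff) auto
  qed auto
  also have "\<dots> \<le> (3/2) ^ k - 1" using three_halves_power_ge[OF k_r(3)] by simp
  finally show "2 powr (1/4 * ?r) \<le> (3/2) ^ k - 1" .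
qed

theorem theorem6:
  shows "\<exists>c::real. c > 0 \<and> (\<exists>n0::nat. \<forall>n\<ge>n0. \<exists>\<phi>. is_2cnf n \<phi> \<and>
           real (xc n (sat_polytope n \<phi>)) \<ge> 2 powr (c * root 4 (real n)))"
proof (intro exI conjI allI impI)
  \<comment> \<open>The existential witnesses are still schematic: this line sets the threshold to
    256, and the last \<open>show\<close> sets \<open>c\<close> to 1/4.\<close>
  fix n :: nat assume n: "256 \<le> n"
  \<comment> \<open>The formula constrains only the first \<open>?k + ?k * ?k\<close> of the
    \<open>n\<close> variables, about the square root of \<open>n\<close>; the others are
    free.\<close>
  let ?k = "nat \<lfloor>root 4 (real n)\<rfloor>"
  let ?xc = "xc n (sat_polytope n (difference_formula ?k))"
  note k = two_powr_root_le[OF n refl]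
  show "is_2cnf n (difference_formula ?k)" using is_2cnf_difference_formula[OF k(1)] .
  have "real (3 ^ ?k) \<le> real ((?xc + 1) * 2 ^ ?k)"
    using xc_difference_formula[OF k(1)] by (rule of_nat_mono)
  then have "(3/2) ^ ?k \<le> real ?xc + 1" by (simp add: power_divide divide_le_eq algebra_simps)
  then show "2 powr (1/4 * root 4 (real n)) \<le> real ?xc" using k(2) by linarith
qed simp

end
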